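(* Let $q$ be a prime power, let $\mathbb{G}_q$ be the bipartite point-line incidence graph of the projective plane $\mathrm{PG}(2,q)$, and let $k$ be a positive integer such that $7k^2-16\leqslant 4q$. Then $\mathbb{G}_q$ is $k$-vertex-minor universal.
   Context: The points and lines of $\mathrm{PG}(2,q)$ are the $1$-dimensional and $2$-dimensional linear subspaces of $\mathbb{F}_q^3$, respectively; a point $a$ lies on a line $\lambda$ (written $a\in\lambda$) if the subspace $a$ is contained in the subspace $\lambda$. The bipartite graph $\mathbb{G}_q$ has left vertex set $L(\mathbb{G}_q)$ the set of points, right vertex set $R(\mathbb{G}_q)$ the set of lines, and edges the pairs $(a,\lambda)$ with $a\in\lambda$; its vertex set is $L(\mathbb{G}_q)\sqcup R(\mathbb{G}_q)$. All graphs are finite, undirected and simple. A local complementation on a vertex $v$ of $G$ complements the subgraph induced by the neighborhood of $v$: the resulting graph has the same vertex set and edge set $E(G)\oplus E(K_{N_G(v)})$, where $K_S$ is the complete graph on $S$ and $\oplus$ is symmetric difference. A graph $G'$ with $V(G')\subseteq V(G)$ is a vertex-minor of $G$ if $G'$ is obtained exactly (not only up to isomorphism) from $G$ by a sequence of local complementations and deletions of the vertices of $V(G)\setminus V(G')$. For an integer $k>0$, $G$ is $k$-vertex-minor universal if $k\leqslant |V(G)|$ and, for every set $K$ of $k$ vertices of $G$, every graph with vertex set $K$ is a vertex-minor of $G$. *)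

theory Defs
  imports "HOL-Analysis.Cartesian_Space" "HOL-Number_Theory.Prime_Powers"
begin

record 'v graph =
  verts :: "'v set"
  edges :: "'v set set"

definition complete_edges :: "'v set \<Rightarrow> 'v set set" where
  "complete_edges S = {{u, v} | u v. u \<in> S \<and> v \<in> S \<and> u \<noteq> v}"

definition simple_graph :: "'v graph \<Rightarrow> bool" where
  "simple_graph G \<longleftrightarrow> finite (verts G) \<and> edges G \<subseteq> complete_edges (verts G)"

definition neighborhood :: "'v graph \<Rightarrow> 'v \<Rightarrow> 'v set" where
  "neighborhood G v = {u. {u, v} \<in> edges G}"

definition local_complement :: "'v graph \<Rightarrow> 'v \<Rightarrow> 'v graph" where
  "local_complement G v =
     \<lparr>verts = verts G, edges = sym_diff (edges G) (complete_edges (neighborhood G v))\<rparr>"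

definition delete_vertex :: "'v graph \<Rightarrow> 'v \<Rightarrow> 'v graph" where
  "delete_vertex G v = \<lparr>verts = verts G - {v}, edges = {e \<in> edges G. v \<notin> e}\<rparr>"

text \<open>
  No operation adds a vertex, so the deleted vertices are automatically exactly those of
  \<open>verts G - verts H\<close> when \<open>H\<close> is obtained from \<open>G\<close>.
\<close>

inductive vertex_minor :: "'v graph \<Rightarrow> 'v graph \<Rightarrow> bool" where
  refl: "vertex_minor G G"
| local_complement:
    "vertex_minor H G \<Longrightarrow> v \<in> verts H \<Longrightarrow> vertex_minor (local_complement H v) G"
| delete_vertex:
    "vertex_minor H G \<Longrightarrow> v \<in> verts H \<Longrightarrow> vertex_minor (delete_vertex H v) G"

definition vertex_minor_universal :: "nat \<Rightarrow> 'v graph \<Rightarrow> bool" where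
  "vertex_minor_universal k G \<longleftrightarrow>
     k \<le> card (verts G) \<and>
     (\<forall>K \<subseteq> verts G. card K = k \<longrightarrow>
        (\<forall>H. simple_graph H \<and> verts H = K \<longrightarrow> vertex_minor H G))"

definition pg_points :: "('a::field ^ 3) set set" where
  "pg_points = {a. vec.subspace a \<and> vec.dim a = 1}"

definition pg_lines :: "('a::field ^ 3) set set" where
  "pg_lines = {l. vec.subspace l \<and> vec.dim l = 2}"

definition incidence_graph :: "(('a::field ^ 3) set + ('a ^ 3) set) graph" where
  "incidence_graph =
     \<lparr>verts = pg_points <+> pg_lines,
      edges = {{Inl a, Inr l} | a l. a \<in> pg_points \<and> l \<in> pg_lines \<and> a \<subseteq> l}\<rparr>"

lemma complete_edges_mono: "S \<subseteq> T \<Longrightarrow> complete_edges S \<subseteq> complete_edges T"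
  unfolding complete_edges_def by blast

lemma simple_graph_local_complement:
  assumes "simple_graph G"
  shows "simple_graph (local_complement G v)"
proof -
  have "neighborhood G v \<subseteq> verts G"
  proof
    fix u assume "u \<in> neighborhood G v"
    then have "{u, v} \<in> complete_edges (verts G)"
      using assms unfolding simple_graph_def neighborhood_def by blast
    then show "u \<in> verts G"
      unfolding complete_edges_def by (auto simp: doubleton_eq_iff)
  qed
  from complete_edges_mono[OF this] show ?thesis
    using assms by (auto simp: simple_graph_def local_complement_def)
qed

lemma simple_graph_delete_vertex:
  assumes "simple_graph G"
  shows "simple_graph (delete_vertex G v)"
proof -
  have "e \<in> complete_edges (verts G - {v})" if e: "e \<in> edges G" "v \<notin> e" for e
  proof -
    obtain x y where "e = {x, y}" "x \<in> verts G" "y \<in> verts G" "x \<noteq> y"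
      using assms e(1) unfolding simple_graph_def complete_edges_def by blast
    with e(2) show ?thesis
      unfolding complete_edges_def by blast
  qed
  then show ?thesis
    using assms by (auto simp: simple_graph_def delete_vertex_def)
qed

lemma vertex_minor_simple_graph:
  assumes "vertex_minor H G" "simple_graph G"
  shows "simple_graph H" "verts H \<subseteq> verts G"
  using assms
proof (induction rule: vertex_minor.induct)
  case (refl G)
  { case 1 then show ?case . }
  { case 2 then show ?case by simp }
next
  case (local_complement H G v)
  { case 1 with local_complement show ?case by (simp add: simple_graph_local_complement) }
  { case 2 with local_complement show ?case by (simp add: local_complement_def) }
next
  case (delete_vertex H G v)
  { case 1 with delete_vertex show ?case by (simp add: simple_graph_delete_vertex) }
  { case 2 with delete_vertex show ?case by (auto simp: delete_vertex_def) }
qed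

lemma simple_graph_incidence_graph:
  "simple_graph (incidence_graph :: (('a::{field,finite} ^ 3) set + ('a ^ 3) set) graph)"
proof -
  have "{Inl a, Inr l} \<in> complete_edges (A <+> B)" if "a \<in> A" "l \<in> B"
    for a l :: "('a ^ 3) set" and A B
    using that unfolding complete_edges_def by blast
  then show ?thesis
    by (auto simp: simple_graph_def incidence_graph_def)
qed

end

theory Submission imports Defs begin

text \<open>
  Eliminating a vertex (local complementation, then deletion) complements its neighbourhood.
  A gadget consists of a point \<open>x\<close> and the lines joining it to the points of a set \<open>C\<close>:
  eliminating the lines towards some \<open>S \<subseteq> C\<close>, and then \<open>x\<close>, complements exactly the edges
  inside \<open>S\<close>. Every graph on \<open>n\<close> vertices is a sum of \<open>n - 1\<close> cliques (isolate the vertices one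
  by one), so \<open>card C - 1\<close> gadgets produce every graph on \<open>C\<close>.

  A line \<open>l\<close> in \<open>K\<close> is traded for a point \<open>p l\<close> on it: if \<open>l\<close> sees only its points in \<open>K\<close> and
  \<open>p l\<close>, then eliminating \<open>p l\<close> at the very end gives \<open>l\<close> any prescribed neighbourhood. Hence it
  suffices to control the edges within a set \<open>C\<close> of \<open>k\<close> points. The next gadget point only has to
  avoid the at most \<open>k\<close> lines in \<open>K\<close>, the lines joining two points of \<open>C\<close>, and the at most
  \<open>k (k - 2)\<close> lines joining \<open>C\<close> to earlier gadget points; \<open>q\<close> lines never cover the plane.
\<close>

section \<open>Vertex-minors: induced subgraphs and elimination of a vertex\<close>

lemma vertex_minor_trans:
  assumes "vertex_minor F G" "vertex_minor G H"
  shows "vertex_minor F H"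
  using assms by (induction rule: vertex_minor.induct) (auto intro: vertex_minor.intros)

lemma vertex_minor_induced:
  assumes "simple_graph G" "W \<subseteq> verts G"
  shows "vertex_minor \<lparr>verts = W, edges = {e \<in> edges G. e \<subseteq> W}\<rparr> G"
proof -
  have sub: "e \<subseteq> verts G" if "e \<in> edges G" for e
    using assms(1) that by (auto simp: simple_graph_def complete_edges_def)
  have fin: "finite (verts G - W)"
    using assms(1) by (simp add: simple_graph_def)
  \<comment> \<open>The vertices outside \<open>W\<close> are deleted one at a time; the induction
    runs over the set \<open>D\<close> already deleted.\<close>
  have "vertex_minor \<lparr>verts = verts G - D, edges = {e \<in> edges G. e \<subseteq> verts G - D}\<rparr> G"
    if "finite D" "D \<subseteq> verts G" for D
    using that
  proof (induction D)
    case empty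
    have "\<lparr>verts = verts G - {}, edges = {e \<in> edges G. e \<subseteq> verts G - {}}\<rparr> = G"
      using sub by (cases G) auto
    then show ?case using vertex_minor.refl[of G] by simp
  next
    case (insert v D)
    let ?H = "\<lparr>verts = verts G - D, edges = {e \<in> edges G. e \<subseteq> verts G - D}\<rparr>"
    have "vertex_minor (delete_vertex ?H v) G"
      using insert by (intro vertex_minor.delete_vertex) auto
    moreover have "delete_vertex ?H v = \<lparr>verts = verts G - insert v D,
        edges = {e \<in> edges G. e \<subseteq> verts G - insert v D}\<rparr>"
      by (auto simp: delete_vertex_def)
    ultimately show ?case by simp
  qed
  from this[OF fin] assms(2) show ?thesis
    by (simp add: double_diff)
qed

text \<open>As \<open>v\<close> is not its own neighbour, local complementation at \<open>v\<close>
  changes no edge at \<open>v\<close>. The deletion then removes old edges only and leaves the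
  toggled clique intact.\<close>

lemma vertex_minor_eliminate:
  assumes "simple_graph G" "v \<in> verts G"
  shows "vertex_minor \<lparr>verts = verts G - {v},
    edges = sym_diff {e \<in> edges G. v \<notin> e} (complete_edges (neighborhood G v))\<rparr> G"
proof -
  have "v \<notin> neighborhood G v"
    using assms(1) by (auto simp: simple_graph_def neighborhood_def complete_edges_def)
  then have "delete_vertex (local_complement G v) v = \<lparr>verts = verts G - {v},
    edges = sym_diff {e \<in> edges G. v \<notin> e} (complete_edges (neighborhood G v))\<rparr>"
    by (auto simp: delete_vertex_def local_complement_def complete_edges_def)
  moreover have "vertex_minor (delete_vertex (local_complement G v) v) G"
    using assms(2)
    by (intro vertex_minor.intros) (auto simp: local_complement_def)
  ultimately show ?thesis by simp
qed

section \<open>Gadgets that complement the edges inside a chosen set\<close>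

lemma complete_edges_restrict: "e \<in> complete_edges S \<Longrightarrow> e \<subseteq> T \<Longrightarrow> e \<in> complete_edges T"
  by (auto simp: complete_edges_def)

lemma complete_edges_doubleton [simp]:
  "{u, v} \<in> complete_edges S \<longleftrightarrow> u \<in> S \<and> v \<in> S \<and> u \<noteq> v"
  by (auto simp: complete_edges_def doubleton_eq_iff)

lemma singleton_notin_complete_edges [simp]: "{v} \<notin> complete_edges S"
  using complete_edges_doubleton[of v v S] by simp

lemma complete_edges_pair: "x \<noteq> y \<Longrightarrow> complete_edges {x, y} = {{x, y}}"
  by (auto simp: complete_edges_def doubleton_eq_iff)

lemma complete_edgesE:
  assumes "e \<in> complete_edges S"
  obtains u v where "e = {u, v}" "u \<in> S" "v \<in> S" "u \<noteq> v"
  using assms by (auto simp: complete_edges_def)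

text \<open>Puts the given endpoint second, the order in which \<open>neighborhood\<close> and
  \<open>incidence_edge_iff\<close> read an edge.\<close>

lemma complete_edges_incidentE:
  assumes "e \<in> complete_edges S" "v \<in> e"
  obtains u where "e = {u, v}" "u \<in> S" "v \<in> S"
proof -
  obtain x y where xy: "e = {x, y}" "x \<in> S" "y \<in> S"
    using assms(1) by (rule complete_edgesE)
  show thesis
  proof (cases "v = y")
    case True
    then show thesis using that[of x] xy by simp
  next
    case False
    then have "v = x" using assms(2) xy(1) by simp
    then show thesis using that[of y] xy by (simp add: insert_commute)
  qed
qed

text \<open>\<open>S\<close> collects the vertices already made adjacent to \<open>x\<close>, \<open>T\<close> those still to be linked.\<close>
lemma vertex_minor_gadget_aux:
  assumes "finite T" "finite V" "E \<subseteq> complete_edges V" "S \<union> T \<subseteq> V" "S \<inter> T = {}"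
    "x \<notin> V" "inj_on m T" "m ` T \<inter> insert x V = {}"
  shows "vertex_minor \<lparr>verts = V, edges = sym_diff E (complete_edges (S \<union> T))\<rparr>
    \<lparr>verts = V \<union> {x} \<union> m ` T,
     edges = E \<union> (\<lambda>b. {x, b}) ` S \<union> (\<lambda>b. {x, m b}) ` T \<union> (\<lambda>b. {m b, b}) ` T\<rparr>"
  using assms
proof (induction T arbitrary: S)
  \<comment> \<open>No connector is left: \<open>x\<close> sees exactly \<open>S\<close>, and
    eliminating it complements \<open>S\<close>.\<close>
  case empty
  let ?G = "\<lparr>verts = V \<union> {x}, edges = E \<union> (\<lambda>b. {x, b}) ` S\<rparr>"
  have x: "x \<notin> e" if "e \<in> E" for e
    using empty that by (auto simp: complete_edges_def)
  have "simple_graph ?G"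
    using empty complete_edges_mono[of V "V \<union> {x}"] by (auto simp: simple_graph_def)
  then have "vertex_minor \<lparr>verts = verts ?G - {x},
      edges = sym_diff {e \<in> edges ?G. x \<notin> e} (complete_edges (neighborhood ?G x))\<rparr> ?G"
    by (intro vertex_minor_eliminate) auto
  moreover have "neighborhood ?G x = S"
    using x empty by (auto simp: neighborhood_def doubleton_eq_iff)
  moreover have "{e \<in> edges ?G. x \<notin> e} = E"
    using x by auto
  ultimately show ?case using empty by (auto simp: insert_Diff_if)
next
  case (insert b T)
  let ?G = "\<lparr>verts = V \<union> {x} \<union> m ` insert b T,
     edges = E \<union> (\<lambda>b. {x, b}) ` S \<union> (\<lambda>b. {x, m b}) ` insert b T \<union> (\<lambda>b. {m b, b}) ` insert b T\<rparr>"
  let ?H = "\<lparr>verts = V \<union> {x} \<union> m ` T,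
     edges = E \<union> (\<lambda>b. {x, b}) ` insert b S \<union> (\<lambda>b. {x, m b}) ` T \<union> (\<lambda>b. {m b, b}) ` T\<rparr>"
  have new: "m b \<notin> V" "m b \<noteq> x" "m b \<notin> m ` T" "b \<in> V" "b \<noteq> x" "b \<notin> S" "b \<notin> m ` T"
    using insert.prems insert.hyps by auto
  have xE: "x \<notin> e" "m b \<notin> e" if "e \<in> E" for e
    using insert.prems(2,5) new that by (auto simp: complete_edges_def)
  have "c \<in> V" "m c \<notin> V" "m c \<noteq> x" if "c \<in> insert b T" for c
    using insert.prems(3,7) that by auto
  then have ins: "c \<in> V" "m c \<noteq> c" "x \<noteq> m c" if "c \<in> insert b T" for c
    using that by metis+
  have "simple_graph ?G"
    using insert.prems(1,2,3,5) insert.hyps(1) complete_edges_mono[of V "verts ?G"]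
    unfolding simple_graph_def by (auto simp: ins)
  then have "vertex_minor \<lparr>verts = verts ?G - {m b},
      edges = sym_diff {e \<in> edges ?G. m b \<notin> e} (complete_edges (neighborhood ?G (m b)))\<rparr> ?G"
    by (intro vertex_minor_eliminate) auto
  \<comment> \<open>The connector \<open>m b\<close> has only the neighbours \<open>x\<close> and
    \<open>b\<close>, so its elimination toggles the single edge \<open>{x, b}\<close>.\<close>
  moreover have "neighborhood ?G (m b) = {x, b}"
    using xE new insert.prems by (auto simp: neighborhood_def doubleton_eq_iff)
  moreover have "verts ?G - {m b} = verts ?H"
    using new by auto
  moreover have "{e \<in> edges ?G. m b \<notin> e} =
      E \<union> (\<lambda>b. {x, b}) ` S \<union> (\<lambda>b. {x, m b}) ` T \<union> (\<lambda>b. {m b, b}) ` T"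
    using xE new insert.prems by auto
  \<comment> \<open>The toggled edge is still absent, so it is added, and \<open>b\<close> passes
    from the vertices to be linked to the linked ones.\<close>
  moreover have "{x, b} \<notin> E \<union> (\<lambda>b. {x, b}) ` S \<union> (\<lambda>b. {x, m b}) ` T \<union> (\<lambda>b. {m b, b}) ` T"
    using xE new insert.prems by (auto simp: doubleton_eq_iff)
  ultimately have "vertex_minor ?H ?G"
    using new(5) by (simp add: complete_edges_pair Un_ac insert_Diff_if)
  moreover have "vertex_minor \<lparr>verts = V, edges = sym_diff E (complete_edges (insert b S \<union> T))\<rparr> ?H"
    using insert.prems insert.hyps by (intro insert.IH) auto
  ultimately show ?case
    using vertex_minor_trans by auto
qed

text \<open>Deleting the connectors of \<open>C - S\<close> leaves the preceding situation with no
  vertex linked yet. Since \<open>S\<close> is chosen only after the gadget is laid out, one fixed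
  configuration serves every target graph.\<close>

lemma vertex_minor_gadget:
  assumes "finite V" "E \<subseteq> complete_edges V" "S \<subseteq> C" "C \<subseteq> V"
    "x \<notin> V" "inj_on m C" "m ` C \<inter> insert x V = {}"
  shows "vertex_minor \<lparr>verts = V, edges = sym_diff E (complete_edges S)\<rparr>
    \<lparr>verts = V \<union> {x} \<union> m ` C, edges = E \<union> (\<lambda>b. {x, m b}) ` C \<union> (\<lambda>b. {m b, b}) ` C\<rparr>"
    (is "vertex_minor _ ?G")
proof -
  let ?H = "\<lparr>verts = V \<union> {x} \<union> m ` S, edges = E \<union> (\<lambda>b. {x, m b}) ` S \<union> (\<lambda>b. {m b, b}) ` S\<rparr>"
  have fin: "finite C" "finite S"
    using assms finite_subset by metis+
  have EV: "e \<subseteq> V" if "e \<in> E" for e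
    using assms(2) that by (auto simp: complete_edges_def)
  have mC: "c \<in> V" "m c \<notin> V" "m c \<noteq> x" if "c \<in> C" for c
    using assms(4,7) that by auto
  then have ins: "c \<in> V" "m c \<noteq> c" "x \<noteq> m c" "c \<noteq> x" if "c \<in> C" for c
    using that assms(5) by metis+
  have "simple_graph ?G"
    using assms(1,2) fin complete_edges_mono[of V "verts ?G"]
    unfolding simple_graph_def by (auto simp: ins)
  then have "vertex_minor \<lparr>verts = verts ?H, edges = {e \<in> edges ?G. e \<subseteq> verts ?H}\<rparr> ?G"
    using assms by (intro vertex_minor_induced) auto
  moreover have "{e \<in> edges ?G. e \<subseteq> verts ?H} = edges ?H"
  proof (intro equalityI subsetI)
    \<comment> \<open>By injectivity of \<open>m\<close>, a connector kept for a vertex of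
      \<open>S\<close> cannot also belong to a vertex of \<open>C - S\<close>.\<close>
    have in_S: "b \<in> S" if b: "b \<in> C" "m b \<in> verts ?H" for b
    proof -
      obtain c where "c \<in> S" "m b = m c" using b mC[of b] by auto
      then show ?thesis using inj_onD[OF assms(6), of b c] b(1) assms(3) by auto
    qed
    fix e assume "e \<in> {e \<in> edges ?G. e \<subseteq> verts ?H}"
    then have e: "e \<in> E \<union> (\<lambda>b. {x, m b}) ` C \<union> (\<lambda>b. {m b, b}) ` C" "e \<subseteq> verts ?H"
      by simp_all
    from e(1) consider "e \<in> E" | b where "b \<in> C" "e = {x, m b}" | b where "b \<in> C" "e = {m b, b}"
      by blast
    then show "e \<in> edges ?H"
    proof cases
      case 1
      then show ?thesis by simp
    next
      case 2
      then have "b \<in> S" using in_S e(2) by blast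
      with 2 show ?thesis by simp
    next
      case 3
      then have "b \<in> S" using in_S e(2) by blast
      with 3 show ?thesis by simp
    qed
  next
    fix e assume "e \<in> edges ?H"
    then consider "e \<in> E" | b where "b \<in> S" "e = {x, m b}" | b where "b \<in> S" "e = {m b, b}"
      by auto
    then show "e \<in> {e \<in> edges ?G. e \<subseteq> verts ?H}"
    proof cases
      case 1
      then show ?thesis using EV by auto
    next
      case 2
      then show ?thesis using assms(3) by auto
    next
      case 3
      then show ?thesis using assms(3,4) by auto
    qed
  qed
  ultimately have "vertex_minor ?H ?G" by simp
  moreover have "S \<subseteq> V" "inj_on m S" "m ` S \<inter> insert x V = {}"
    using assms(3,4,7) inj_on_subset[OF assms(6,3)] by blast+
  then have "vertex_minor \<lparr>verts = V, edges = sym_diff E (complete_edges S)\<rparr> ?H"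
    using vertex_minor_gadget_aux[of S V E "{}" x m] assms(1,2,5) fin(2) by simp
  ultimately show ?thesis using vertex_minor_trans by blast
qed

text \<open>Each centre in \<open>X\<close> is joined to each \<open>b\<close> in \<open>C\<close>
  by a path of length two through the connector \<open>m x b\<close>. In the plane the connector is
  the line through the points \<open>x\<close> and \<open>b\<close>.\<close>

definition gadget_edges :: "'v set \<Rightarrow> ('v \<Rightarrow> 'v \<Rightarrow> 'v) \<Rightarrow> 'v set \<Rightarrow> 'v set set" where
  "gadget_edges X m C = (\<Union>x\<in>X. (\<lambda>b. {x, m x b}) ` C \<union> (\<lambda>b. {m x b, b}) ` C)"

text \<open>Each gadget takes one vertex out of the set \<open>D\<close> that carries the difference
  between the current edges \<open>E\<close> and the target \<open>F\<close>, so \<open>E\<close>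
  and \<open>D\<close> vary in the induction. A single vertex carries no edge, hence the
  \<open>+ 1\<close>.\<close>

lemma vertex_minor_gadgets:
  assumes "finite X" "finite V" "C \<subseteq> V" "X \<inter> V = {}"
    "inj_on (case_prod m) (X \<times> C)" "case_prod m ` (X \<times> C) \<inter> (X \<union> V) = {}"
    "E \<subseteq> complete_edges V" "D \<subseteq> C" "card D \<le> card X + 1"
    "sym_diff E F \<subseteq> complete_edges D"
  shows "vertex_minor \<lparr>verts = V, edges = F\<rparr>
    \<lparr>verts = V \<union> X \<union> case_prod m ` (X \<times> C), edges = E \<union> gadget_edges X m C\<rparr>"
  using assms
proof (induction X arbitrary: E D)
  case empty
  then have "finite D" using finite_subset by metis
  with empty have "complete_edges D = {}"
    by (auto simp: complete_edges_def card_le_Suc0_iff_eq)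
  with empty have "E = F" by auto
  then show ?case by (simp add: gadget_edges_def vertex_minor.refl)
next
  case (insert x X)
  have finD: "finite D" using insert.prems finite_subset by metis
  obtain D' S where D': "D' \<subseteq> D" "card D' \<le> card X + 1" "S \<subseteq> D"
    "sym_diff (sym_diff E (complete_edges S)) F \<subseteq> complete_edges D'"
  proof (cases "D = {}")
    case True
    \<comment> \<open>With \<open>D\<close> empty nothing is wrong, and the gadget is spent on the
      empty clique.\<close>
    then show thesis using that[of "{}" "{}"] insert.prems by (auto simp: complete_edges_def)
  next
    case False
    then obtain a where a: "a \<in> D" by blast
    \<comment> \<open>The clique on \<open>S\<close> corrects all edges at \<open>a\<close>; wrong edges elsewhere are left to the
      remaining gadgets.\<close>
    define S where "S = insert a {b \<in> D. {a, b} \<in> sym_diff E F}"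
    have "sym_diff (sym_diff E (complete_edges S)) F \<subseteq> complete_edges (D - {a})"
    proof
      fix e assume e: "e \<in> sym_diff (sym_diff E (complete_edges S)) F"
      have "S \<subseteq> D" using a by (auto simp: S_def)
      then have "e \<in> complete_edges D"
        using e insert.prems(9) complete_edges_mono[of S D] by blast
      moreover have "a \<notin> e"
      proof
        assume "a \<in> e"
        with \<open>e \<in> complete_edges D\<close> obtain b where b: "e = {a, b}" "b \<in> D" "b \<noteq> a"
          by (auto elim!: complete_edgesE)
        \<comment> \<open>As \<open>a\<close> itself is in \<open>S\<close>, the clique contains
          \<open>{a, b}\<close> exactly when this pair is wrong, so toggling repairs every pair at
          \<open>a\<close>.\<close>
        then have "e \<in> complete_edges S \<longleftrightarrow> e \<in> sym_diff E F"
          using a by (auto simp: S_def)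
        with e show False by blast
      qed
      ultimately show "e \<in> complete_edges (D - {a})"
        by (auto simp: complete_edges_def)
    qed
    moreover have "card (D - {a}) \<le> card X + 1"
      using insert a finD by simp
    ultimately show thesis
      using that[of "D - {a}" S] a by (auto simp: S_def)
  qed
  \<comment> \<open>The gadget of \<open>x\<close> is used first; the other gadgets are counted
    among the vertices and edges to be preserved.\<close>
  let ?V = "V \<union> X \<union> case_prod m ` (X \<times> C)"
  let ?E = "E \<union> gadget_edges X m C"
  have finC: "finite C" using insert.prems finite_subset by metis
  have m_new: "m y b \<notin> V" "m y b \<notin> X" "m y b \<noteq> x" "b \<in> V" if "y \<in> insert x X" "b \<in> C" for y b
  proof -
    have "m y b \<in> case_prod m ` (insert x X \<times> C)" using that by force
    with insert.prems(5) show "m y b \<notin> V" "m y b \<notin> X" "m y b \<noteq> x" by blast+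
    show "b \<in> V" using that insert.prems(2) by blast
  qed
  have "m x b \<noteq> m y c" if "y \<in> X" "b \<in> C" "c \<in> C" for y b c
    using inj_onD[OF insert.prems(4), of "(x, b)" "(y, c)"] that insert.hyps by auto
  moreover have "m x b \<notin> insert x (V \<union> X)" if "b \<in> C" for b
    using m_new[of x b] that by auto
  ultimately have mx: "m x ` C \<inter> insert x ?V = {}"
    by fastforce
  have m_edge: "x \<noteq> m x b" "m x b \<noteq> b" if "x \<in> X" "b \<in> C" for x b
    using m_new[of x b] that by auto
  then have gV: "gadget_edges X m C \<subseteq> complete_edges ?V"
    using m_new(4) by (force simp: gadget_edges_def)
  have step: "vertex_minor \<lparr>verts = ?V, edges = sym_diff ?E (complete_edges S)\<rparr>
    \<lparr>verts = ?V \<union> {x} \<union> m x ` C,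
     edges = ?E \<union> (\<lambda>b. {x, m x b}) ` C \<union> (\<lambda>b. {m x b, b}) ` C\<rparr>"
  proof (rule vertex_minor_gadget)
    show "?E \<subseteq> complete_edges ?V"
      using gV insert.prems(6) complete_edges_mono[of V ?V] by blast
    show "inj_on (m x) C"
      using inj_onD[OF insert.prems(4)] by (intro inj_onI) auto
    show "x \<notin> ?V" using insert.prems(3) insert.hyps m_new(3) by auto
    show "S \<subseteq> C" using D' insert.prems by blast
  qed (use insert finC mx in auto)
  have verts_eq: "?V \<union> {x} \<union> m x ` C = V \<union> insert x X \<union> case_prod m ` (insert x X \<times> C)"
    by (auto simp: image_iff)
  have edges_eq: "?E \<union> (\<lambda>b. {x, m x b}) ` C \<union> (\<lambda>b. {m x b, b}) ` C = E \<union> gadget_edges (insert x X) m C"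
    by (auto simp: gadget_edges_def)
  \<comment> \<open>Every edge of another gadget ends in a connector outside \<open>V\<close>,
    whereas the clique on \<open>S\<close> lies inside \<open>V\<close>; toggling it leaves those
    gadgets intact.\<close>
  have "gadget_edges X m C \<inter> complete_edges V = {}"
    using m_new(1) by (auto simp: gadget_edges_def)
  then have diff_eq: "sym_diff ?E (complete_edges S) = sym_diff E (complete_edges S) \<union> gadget_edges X m C"
    using complete_edges_mono[of S V] D'(3) insert.prems(2,7) by blast
  have rest: "vertex_minor \<lparr>verts = V, edges = F\<rparr>
     \<lparr>verts = ?V, edges = sym_diff E (complete_edges S) \<union> gadget_edges X m C\<rparr>"
  proof (rule insert.IH)
    show "inj_on (case_prod m) (X \<times> C)"
      using insert.prems(4) by (rule inj_on_subset) auto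
    show "sym_diff E (complete_edges S) \<subseteq> complete_edges V"
      using complete_edges_mono[of S V] D'(3) insert.prems(2,6,7) by blast
    show "D' \<subseteq> C" using D' insert.prems by blast
    show "case_prod m ` (X \<times> C) \<inter> (X \<union> V) = {}" using m_new by auto
  qed (use D' insert in auto)
  show ?case
    using vertex_minor_trans[OF rest step[unfolded diff_eq]] unfolding verts_eq edges_eq .
qed

section \<open>Prescribing the neighbourhoods of the vertices in a set\<close>

text \<open>Elimination is read backwards: adding a vertex adjacent to all of \<open>T\<close> and
  complementing inside \<open>T\<close> is undone by eliminating that vertex. Applied once for each
  \<open>l\<close>, this hides the arbitrary adjacencies of \<open>L\<close> in \<open>H\<close>
  among the vertices outside \<open>L\<close>.\<close>

lemma exists_pendant_extension:
  assumes "finite L" "L \<subseteq> U" "simple_graph H" "verts H = U"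
    "inj_on p L" "p ` L \<inter> U = {}" "\<And>l. l \<in> L \<Longrightarrow> A l \<subseteq> U - L"
  shows "\<exists>G. simple_graph G \<and> verts G = U \<union> p ` L \<and> vertex_minor H G \<and>
    (\<forall>l\<in>L. neighborhood G l = insert (p l) (A l))"
proof -
  have "\<exists>G. simple_graph G \<and> verts G = U \<union> p ` M \<and> vertex_minor H G \<and>
    (\<forall>l\<in>M. neighborhood G l = insert (p l) (A l))" if "finite M" "M \<subseteq> L" for M
    using that
  proof (induction M)
    case empty
    then show ?case using assms vertex_minor.refl[of H] by auto
  next
    case (insert l M)
    then obtain G where G: "simple_graph G" "verts G = U \<union> p ` M" "vertex_minor H G"
      "\<And>l. l \<in> M \<Longrightarrow> neighborhood G l = insert (p l) (A l)" by auto
    \<comment> \<open>Eliminating the new vertex \<open>p l\<close>, with neighbourhood \<open>T\<close>, turns \<open>A l\<close> into the wanted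
      neighbourhood of \<open>l\<close> and leaves the vertices of \<open>M\<close> alone, as none of them is in \<open>T\<close>.\<close>
    define T where "T = insert l (sym_diff (neighborhood G l) (A l))"
    define G' where "G' = \<lparr>verts = insert (p l) (verts G),
      edges = sym_diff (edges G) (complete_edges T) \<union> (\<lambda>t. {p l, t}) ` T\<rparr>"
    have lL: "l \<in> L" "l \<in> U" using insert.prems assms(2) by auto
    have pl: "p l \<notin> verts G"
      using G(2) assms(5,6) insert by (auto dest!: inj_onD)
    have NG: "neighborhood G v \<subseteq> verts G - {v}" for v
      using G(1) by (force simp: simple_graph_def neighborhood_def dest!: subsetD)
    have TV: "T \<subseteq> verts G" using NG[of l] lL G(2) assms(7)[of l] by (auto simp: T_def)
    have lT: "l \<notin> neighborhood G l" "l \<notin> A l" using NG[of l] assms(7)[of l] lL by auto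
    have eG: "e \<subseteq> verts G" if "e \<in> edges G" for e
      using G(1) that by (auto simp: simple_graph_def complete_edges_def)
    have simple: "simple_graph G'"
      using G(1) TV pl complete_edges_mono[of T "insert (p l) (verts G)"]
        complete_edges_mono[of "verts G" "insert (p l) (verts G)"]
      by (auto simp: simple_graph_def G'_def)
    have "neighborhood G' (p l) = T"
      using eG pl TV by (auto simp: neighborhood_def G'_def doubleton_eq_iff)
    moreover have "{e \<in> edges G'. p l \<notin> e} = sym_diff (edges G) (complete_edges T)"
      using eG pl TV by (auto simp: G'_def elim!: complete_edgesE)
    moreover have "sym_diff (sym_diff (edges G) (complete_edges T)) (complete_edges T) = edges G"
      by blast
    moreover have "verts G' - {p l} = verts G" using pl by (auto simp: G'_def)
    ultimately have "vertex_minor \<lparr>verts = verts G, edges = edges G\<rparr> G'"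
      using vertex_minor_eliminate[OF simple, of "p l"] by (auto simp: G'_def)
    then have "vertex_minor H G'"
      using G(3) vertex_minor_trans by (cases G) auto
    moreover have "neighborhood G' l = insert (p l) (A l)"
    proof -
      have "l \<noteq> p l" using pl lL G(2) by auto
      \<comment> \<open>Complementing inside \<open>T\<close> toggles, at \<open>l\<close>, exactly
        the pairs where the current neighbourhood differs from \<open>A l\<close>; the only other
        change at \<open>l\<close> is the new neighbour \<open>p l\<close>.\<close>
      then have "u \<in> neighborhood G' l \<longleftrightarrow> u \<in> insert (p l) (A l)" for u
        using lT pl eG[of "{u, l}"] TV
        by (auto simp: neighborhood_def G'_def doubleton_eq_iff T_def)
      then show ?thesis by blast
    qed
    moreover have "neighborhood G' l' = insert (p l') (A l')" if l': "l' \<in> M" for l'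
    proof -
      have *: "l' \<in> L" "l' \<noteq> l" using insert l' by auto
      have "p l' \<noteq> l" using * assms(6) lL by auto
      \<comment> \<open>The neighbours of \<open>l'\<close> are \<open>p l'\<close>, which lies
        outside \<open>U\<close>, and \<open>A l'\<close>, which avoids \<open>L\<close>. So
        \<open>l\<close> is not among them.\<close>
      then have "l \<notin> neighborhood G l'"
        using G(4)[OF l'] assms(7)[OF *(1)] lL by auto
      then have "l' \<notin> neighborhood G l"
        by (auto simp: neighborhood_def insert_commute)
      then have "l' \<notin> T" using * assms(7)[OF lL(1)] by (auto simp: T_def)
      moreover have "l' \<noteq> p l" using pl G(2) * assms(2) by auto
      ultimately have "neighborhood G' l' = neighborhood G l'"
        using pl by (auto simp: neighborhood_def G'_def doubleton_eq_iff)
      then show ?thesis using G(4)[OF l'] by simp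
    qed
    ultimately show ?case
      using simple G(2) by (intro exI[of _ G']) (auto simp: G'_def)
  qed
  then show ?thesis using assms(1) by blast
qed

section \<open>Counting vectors over a finite field\<close>

text \<open>Coordinates with respect to a basis \<open>B\<close> give a bijection from the functions
  on \<open>B\<close> to \<open>S\<close>. Taking the functions in \<open>PiE\<close> fixes their
  values off \<open>B\<close>, which makes \<open>f\<close> injective.\<close>

lemma card_subspace:
  fixes S :: "('a::{field,finite} ^ 'n) set"
  assumes "vec.subspace S"
  shows "card S = CARD('a) ^ vec.dim S"
proof -
  obtain B where B: "B \<subseteq> S" "vec.independent B" "vec.span B = S" "card B = vec.dim S"
    using vec.basis_exists vec.span_subspace[OF _ _ assms] by metis
  have fin: "finite B" by (rule finite)
  define f where "f = (\<lambda>u. \<Sum>v\<in>B. u v *s v)"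
  have "f ` (B \<rightarrow>\<^sub>E UNIV) = S"
  proof
    have "f u \<in> vec.span B" for u
      unfolding f_def by (intro vec.span_sum vec.span_scale vec.span_base)
    then show "f ` (B \<rightarrow>\<^sub>E UNIV) \<subseteq> S"
      using B(3) by blast
    show "S \<subseteq> f ` (B \<rightarrow>\<^sub>E UNIV)"
    proof
      fix x assume "x \<in> S"
      then obtain u where "x = f u"
        using B(3) vec.span_finite[OF fin] by (auto simp: f_def)
      then have "x = f (restrict u B)" by (auto simp: f_def intro: sum.cong)
      then show "x \<in> f ` (B \<rightarrow>\<^sub>E UNIV)" by auto
    qed
  qed
  moreover have "inj_on f (B \<rightarrow>\<^sub>E UNIV)"
  proof (rule inj_onI)
    fix u w assume u: "u \<in> B \<rightarrow>\<^sub>E UNIV" and w: "w \<in> B \<rightarrow>\<^sub>E UNIV" and "f u = f w"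
    then have "(\<Sum>v\<in>B. (u v - w v) *s v) = 0"
      by (simp add: f_def vec.scale_left_diff_distrib sum_subtractf)
    then have "u v = w v" if "v \<in> B" for v
      using B(2) that fin vec.independentD[of B B "\<lambda>v. u v - w v"] by auto
    with u w show "u = w" by (meson PiE_ext)
  qed
  ultimately have "card S = card (B \<rightarrow>\<^sub>E (UNIV :: 'a set))"
    using card_image by metis
  then show ?thesis using B(4) fin by (simp add: card_PiE)
qed

lemma card_field_ge_2: "CARD('a::{field,finite}) \<ge> 2"
proof -
  have "card {0, 1 :: 'a} \<le> CARD('a)" by (rule card_mono) auto
  then show ?thesis by simp
qed

text \<open>Only non-zero vectors are counted. With \<open>q = CARD('a)\<close>, a cover would
  contain at most \<open>q * (q ^ d - 1)\<close> of them, but \<open>S\<close> has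
  \<open>q ^ (d + 1) - 1\<close>, which is larger. Counting zero as well would give no contradiction
  for \<open>q\<close> subspaces.\<close>

lemma exists_vector_avoiding_subspaces:
  fixes S :: "('a::{field,finite} ^ 'n) set" and \<B> :: "('a ^ 'n) set set"
  assumes "vec.subspace S" "vec.dim S = Suc d" "d > 0"
    "\<And>B. B \<in> \<B> \<Longrightarrow> vec.subspace B \<and> vec.dim B \<le> d" "card \<B> \<le> CARD('a)"
  shows "\<exists>v\<in>S. v \<noteq> 0 \<and> v \<notin> \<Union>\<B>"
proof (rule ccontr)
  let ?q = "CARD('a)"
  assume "\<not> ?thesis"
  then have "S - {0} \<subseteq> (\<Union>B\<in>\<B>. B - {0})" by blast
  then have "card (S - {0}) \<le> card (\<Union>B\<in>\<B>. B - {0})"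
    by (rule card_mono[rotated]) simp
  also have "\<dots> \<le> (\<Sum>B\<in>\<B>. card (B - {0}))"
    by (rule card_UN_le) simp
  also have "\<dots> \<le> (\<Sum>B\<in>\<B>. ?q ^ d - 1)"
  proof (rule sum_mono)
    fix B assume "B \<in> \<B>"
    then have B: "vec.subspace B" "vec.dim B \<le> d" using assms(4) by auto
    then have "card B \<le> ?q ^ d" by (simp add: card_subspace power_increasing Suc_leI)
    then show "card (B - {0}) \<le> ?q ^ d - 1" using vec.subspace_0[OF B(1)] by simp
  qed
  also have "\<dots> \<le> ?q * (?q ^ d - 1)" using assms(5) by simp
  finally have "?q * ?q ^ d - 1 \<le> ?q * ?q ^ d - ?q"
    using assms(1,2) vec.subspace_0[OF assms(1)] by (simp add: card_subspace diff_mult_distrib2)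
  \<comment> \<open>Guards the truncated subtraction on the right-hand side before it is compared
    with the left one.\<close>
  moreover have "?q * 1 \<le> ?q * ?q ^ d" by (intro mult_le_mono2) simp
  ultimately show False using card_field_ge_2[where 'a='a] by linarith
qed

section \<open>Points and lines of the projective plane\<close>

definition join :: "('a::field ^ 3) set \<Rightarrow> ('a ^ 3) set \<Rightarrow> ('a ^ 3) set" where
  "join a b = vec.span (a \<union> b)"

lemma join_commute: "join a b = join b a"
  by (simp add: join_def Un_commute)

lemma subset_join: "a \<subseteq> join a b" "b \<subseteq> join a b"
  using vec.span_superset[of "a \<union> b"] by (auto simp: join_def)

lemma pg_points_span:
  assumes "v \<noteq> 0"
  shows "vec.span {v} \<in> pg_points"
  using assms vec.dim_eq_card_independent[of "{v}"]
  by (simp add: pg_points_def)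

lemma pg_pointE:
  assumes "a \<in> pg_points"
  obtains v where "v \<noteq> 0" "a = vec.span {v}"
proof -
  have a: "vec.subspace a" "vec.dim a = 1" using assms by (auto simp: pg_points_def)
  obtain B where B: "B \<subseteq> a" "vec.independent B" "vec.span B = a" "card B = vec.dim a"
    using vec.basis_exists vec.span_subspace[OF _ _ a(1)] by metis
  then obtain v where "B = {v}" using a(2) card_1_singletonE by metis
  with B that[of v] show thesis by auto
qed

lemma pg_point_subset_eq:
  assumes "a \<in> pg_points" "b \<in> pg_points" "a \<subseteq> b"
  shows "a = b"
  using assms vec.subspace_dim_equal[of a b] by (auto simp: pg_points_def)

lemma pg_line_subset_eq:
  assumes "l \<in> pg_lines" "m \<in> pg_lines" "l \<subseteq> m"
  shows "l = m"
  using assms vec.subspace_dim_equal[of l m] by (auto simp: pg_lines_def)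

text \<open>A generator of \<open>b\<close> lies outside \<open>a\<close>, for otherwise
  \<open>b\<close> would be contained in \<open>a\<close> and hence equal to it. So generators of
  the two points form a basis of the join.\<close>

lemma join_line:
  assumes "a \<in> pg_points" "b \<in> pg_points" "a \<noteq> b"
  shows "join a b \<in> pg_lines"
proof -
  obtain v where v: "v \<noteq> 0" "a = vec.span {v}" using assms(1) pg_pointE by blast
  obtain w where w: "w \<noteq> 0" "b = vec.span {w}" using assms(2) pg_pointE by blast
  have nv: "w \<notin> vec.span {v}"
  proof
    assume "w \<in> vec.span {v}"
    then have "b \<subseteq> a" using v w by (simp add: vec.span_minimal)
    with pg_point_subset_eq assms show False by metis
  qed
  then have "vec.independent {w, v}"
    using v by (intro vec.independent_insertI) (auto simp: vec.independent_empty)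
  moreover have "w \<noteq> v" using nv vec.span_base by auto
  moreover have "join a b = vec.span {w, v}"
  proof
    have "vec.span {v} \<subseteq> vec.span {w, v}" "vec.span {w} \<subseteq> vec.span {w, v}"
      by (auto intro!: vec.span_mono)
    then show "join a b \<subseteq> vec.span {w, v}"
      unfolding join_def v w by (intro vec.span_minimal) auto
    show "vec.span {w, v} \<subseteq> join a b"
      unfolding join_def v w by (intro vec.span_mono) (auto simp: vec.span_base)
  qed
  ultimately show ?thesis
    using vec.dim_eq_card_independent[of "{w, v}"] by (simp add: pg_lines_def)
qed

lemma line_eq_join:
  assumes "a \<in> pg_points" "b \<in> pg_points" "a \<noteq> b" "l \<in> pg_lines" "a \<subseteq> l" "b \<subseteq> l"
  shows "l = join a b"
proof -
  have "join a b \<subseteq> l"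
    unfolding join_def using assms by (intro vec.span_minimal) (auto simp: pg_lines_def)
  then show ?thesis using pg_line_subset_eq join_line assms by metis
qed

text \<open>An intersection of dimension two would be all of \<open>l\<close>, and then
  \<open>l\<close> would equal \<open>m\<close>. The bound lets the intersections serve as subspaces
  to be avoided inside \<open>l\<close>.\<close>

lemma dim_inter_lines:
  assumes "l \<in> pg_lines" "m \<in> pg_lines" "l \<noteq> m"
  shows "vec.subspace (l \<inter> m)" "vec.dim (l \<inter> m) \<le> 1"
proof -
  have lm: "vec.subspace l" "vec.dim l = 2" "vec.subspace m"
    using assms by (auto simp: pg_lines_def)
  then show sub: "vec.subspace (l \<inter> m)" by (simp add: vec.subspace_inter)
  show "vec.dim (l \<inter> m) \<le> 1"
  proof (rule ccontr)
    assume "\<not> ?thesis"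
    then have "l \<inter> m = l" using vec.subspace_dim_equal[OF sub lm(1)] lm(2) by auto
    then show False using pg_line_subset_eq[of l m] assms by blast
  qed
qed

section \<open>Choosing points that avoid given lines and points\<close>

text \<open>The covering bound with \<open>d = 2\<close> in the whole space; an uncovered vector
  spans the point.\<close>

lemma exists_point_off_lines:
  fixes \<B> :: "('a::{field,finite} ^ 3) set set"
  assumes "\<B> \<subseteq> pg_lines" "card \<B> \<le> CARD('a)"
  shows "\<exists>x\<in>pg_points. \<forall>l\<in>\<B>. \<not> x \<subseteq> l"
proof -
  have "vec.subspace l \<and> vec.dim l \<le> 2" if "l \<in> \<B>" for l
    using assms(1) that by (auto simp: pg_lines_def)
  then obtain v where v: "v \<noteq> 0" "v \<notin> \<Union>\<B>"
    using exists_vector_avoiding_subspaces[of "UNIV :: ('a ^ 3) set" 2 \<B>] assms(2)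
    by (auto simp: card_cart_basis)
  then show ?thesis
    using vec.span_base[of v "{v}"] pg_points_span[OF v(1)] by (intro bexI[of _ "vec.span {v}"]) auto
qed

text \<open>The covering bound with \<open>d = 1\<close> inside \<open>l\<close>: every other line
  and every forbidden point excludes a subspace of dimension at most one.\<close>

lemma exists_point_on_line_avoiding:
  fixes \<M> P :: "('a::{field,finite} ^ 3) set set"
  assumes "l \<in> pg_lines" "l \<notin> \<M>" "\<M> \<subseteq> pg_lines" "P \<subseteq> pg_points" "card \<M> + card P \<le> CARD('a)"
  shows "\<exists>x\<in>pg_points - P. x \<subseteq> l \<and> (\<forall>m\<in>\<M>. \<not> x \<subseteq> m)"
proof -
  let ?B = "(\<lambda>m. l \<inter> m) ` \<M> \<union> P"
  have fin: "finite \<M>" "finite P" by (rule finite)+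
  have "card ?B \<le> CARD('a)"
    using card_Un_le[of "(\<lambda>m. l \<inter> m) ` \<M>" P] card_image_le[OF fin(1), of "\<lambda>m. l \<inter> m"] assms(5)
    by linarith
  moreover have "vec.subspace B \<and> vec.dim B \<le> 1" if "B \<in> ?B" for B
  proof -
    from that consider m where "m \<in> \<M>" "B = l \<inter> m" | "B \<in> P" by blast
    then show ?thesis
    proof cases
      case 1
      then show ?thesis using dim_inter_lines[of l m] assms(1-3) by blast
    next
      case 2
      then show ?thesis using assms(4) by (auto simp: pg_points_def)
    qed
  qed
  ultimately obtain v where v: "v \<in> l" "v \<noteq> 0" "v \<notin> \<Union>?B"
    using exists_vector_avoiding_subspaces[of l 1 ?B] assms(1) by (auto simp: pg_lines_def)
  have "vec.span {v} \<subseteq> l" using v(1) assms(1) by (intro vec.span_minimal) (auto simp: pg_lines_def)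
  moreover have "v \<in> vec.span {v}" by (simp add: vec.span_base)
  ultimately show ?thesis
    using v pg_points_span[OF v(2)] by (intro bexI[of _ "vec.span {v}"]) auto
qed

text \<open>Each non-zero vector lies in the point that it spans, so the points cover the space.
  This crude bound suffices to see that the graph has at least \<open>k\<close> vertices.\<close>

lemma card_pg_points_ge: "CARD('a) \<le> card (pg_points :: ('a::{field,finite} ^ 3) set set)"
proof (rule ccontr)
  assume "\<not> ?thesis"
  then obtain v :: "'a ^ 3" where v: "v \<noteq> 0" "v \<notin> \<Union>pg_points"
    using exists_vector_avoiding_subspaces[of "UNIV :: ('a ^ 3) set" 2 pg_points]
    by (auto simp: pg_points_def card_cart_basis)
  with pg_points_span[OF v(1)] vec.span_base[of v "{v}"] show False by blast
qed

text \<open>On \<open>l\<close>, only the other lines of \<open>L\<close> and the points of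
  \<open>P\<close> are obstacles; \<open>l\<close> itself is not, hence the \<open>+ 1\<close>.
  Since \<open>p l\<close> lies on no other line of \<open>L\<close>, the choice is
  injective.\<close>

lemma exists_points_on_lines:
  fixes P L :: "('a::{field,finite} ^ 3) set set"
  assumes "P \<subseteq> pg_points" "L \<subseteq> pg_lines" "card P + card L \<le> CARD('a) + 1"
  shows "\<exists>p. \<forall>l\<in>L. p l \<in> pg_points - P \<and> p l \<subseteq> l \<and> (\<forall>m\<in>L - {l}. \<not> p l \<subseteq> m)"
proof -
  have "\<exists>x. x \<in> pg_points - P \<and> x \<subseteq> l \<and> (\<forall>m\<in>L - {l}. \<not> x \<subseteq> m)" if "l \<in> L" for l
  proof -
    have "card (L - {l}) + card P \<le> CARD('a)"
      using assms(3) that card_gt_0_iff[of L] finite[of L] by (auto simp: card_Diff_singleton)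
    then show ?thesis
      using exists_point_on_line_avoiding[of l "L - {l}" P] assms that by blast
  qed
  then show ?thesis by (intro bchoice ballI)
qed

text \<open>The centres are chosen greedily. The last one has \<open>n - 1\<close> predecessors,
  which gives the factor \<open>n - 1\<close>.\<close>

lemma exists_gadget_centres:
  fixes C L :: "('a::{field,finite} ^ 3) set set"
  assumes "C \<subseteq> pg_points" "L \<subseteq> pg_lines"
    "n > 0 \<longrightarrow> 2 \<le> card C \<and> card L + (card C choose 2) + card C * (n - 1) \<le> CARD('a)"
  shows "\<exists>X. card X = n \<and> X \<subseteq> pg_points - C \<and> (\<forall>x\<in>X. \<forall>l\<in>L. \<not> x \<subseteq> l) \<and>
    (\<forall>x\<in>X. \<forall>a\<in>C. \<forall>b\<in>C. a \<noteq> b \<longrightarrow> \<not> x \<subseteq> join a b) \<and>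
    (\<forall>x\<in>X. \<forall>y\<in>X. \<forall>a\<in>C. x \<noteq> y \<longrightarrow> \<not> x \<subseteq> join a y)"
  using assms(3)
proof (induction n)
  case 0
  then show ?case by (intro exI[of _ "{}"]) auto
next
  case (Suc n)
  have card2: "2 \<le> card C" and bound: "card L + (card C choose 2) + card C * n \<le> CARD('a)"
    using Suc.prems by auto
  have "card C * (n - 1) \<le> card C * n" by (rule mult_le_mono2) simp
  then have prem: "n > 0 \<longrightarrow> 2 \<le> card C \<and> card L + (card C choose 2) + card C * (n - 1) \<le> CARD('a)"
    using card2 bound by (meson add_left_mono order_trans)
  obtain X where X: "card X = n" "X \<subseteq> pg_points - C" "\<forall>x\<in>X. \<forall>l\<in>L. \<not> x \<subseteq> l"
    "\<forall>x\<in>X. \<forall>a\<in>C. \<forall>b\<in>C. a \<noteq> b \<longrightarrow> \<not> x \<subseteq> join a b"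
    "\<forall>x\<in>X. \<forall>y\<in>X. \<forall>a\<in>C. x \<noteq> y \<longrightarrow> \<not> x \<subseteq> join a y"
    using Suc.IH[OF prem] by (elim exE conjE)
  \<comment> \<open>Indexing the joins by two-element subsets, not by ordered pairs, keeps their
    number within \<open>card C choose 2\<close>.\<close>
  define J where "J = (\<lambda>e. vec.span (\<Union>e)) ` {e. e \<subseteq> C \<and> card e = 2}"
  define M where "M = case_prod join ` (C \<times> X)"
  have fin: "finite C" "finite L" "finite X" "finite J" "finite M" by (rule finite)+
  have J: "join a b \<in> J" if "a \<in> C" "b \<in> C" "a \<noteq> b" for a b
  proof -
    have "join a b = vec.span (\<Union>{a, b})" by (simp add: join_def)
    moreover have "{a, b} \<in> {e. e \<subseteq> C \<and> card e = 2}" using that by auto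
    ultimately show ?thesis unfolding J_def by (rule image_eqI)
  qed
  have "J \<subseteq> pg_lines"
  proof
    fix l assume "l \<in> J"
    then obtain e where e: "e \<subseteq> C" "card e = 2" "l = vec.span (\<Union>e)"
      unfolding J_def by blast
    then obtain a b where ab: "e = {a, b}" "a \<noteq> b" by (metis card_2_iff)
    then have "l = join a b" using e(3) by (simp add: join_def)
    moreover have "a \<in> pg_points" "b \<in> pg_points" using ab(1) e(1) assms(1) by blast+
    ultimately show "l \<in> pg_lines" using join_line ab(2) by metis
  qed
  moreover have "M \<subseteq> pg_lines"
  proof
    fix l assume "l \<in> M"
    then obtain a y where "l = join a y" "a \<in> C" "y \<in> X" unfolding M_def by auto
    moreover from this have "a \<in> pg_points" "y \<in> pg_points" "a \<noteq> y" using X(2) assms(1) by blast+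
    ultimately show "l \<in> pg_lines" using join_line by metis
  qed
  moreover have "card J \<le> card C choose 2"
    unfolding J_def using n_subsets[OF fin(1), of 2] card_image_le[of "{e. e \<subseteq> C \<and> card e = 2}"]
    by (metis (no_types, lifting) finite)
  moreover have "card M \<le> card C * n"
    unfolding M_def using card_image_le[of "C \<times> X" "case_prod join"] X(1) by (simp add: card_cartesian_product)
  moreover have "card (L \<union> J \<union> M) \<le> card L + card J + card M"
    by (meson add_right_mono card_Un_le order_trans)
  ultimately have "L \<union> J \<union> M \<subseteq> pg_lines" "card (L \<union> J \<union> M) \<le> CARD('a)"
    using assms(2) bound by (blast, linarith)
  from exists_point_off_lines[OF this] obtain x
    where x: "x \<in> pg_points" "\<forall>l\<in>L \<union> J \<union> M. \<not> x \<subseteq> l" by (elim bexE)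
  have xJ: "\<not> x \<subseteq> join a b" if "a \<in> C" "b \<in> C" "a \<noteq> b" for a b
    using J[OF that] x(2) by blast
  have xM: "\<not> x \<subseteq> join a y" if "a \<in> C" "y \<in> X" for a y
  proof -
    have "join a y \<in> M" unfolding M_def using that by (intro image_eqI[of _ _ "(a, y)"]) simp_all
    then show ?thesis using x(2) by blast
  qed
  \<comment> \<open>As \<open>C\<close> has at least two points, each of them lies on a join in
    \<open>J\<close>.\<close>
  have xC: "x \<notin> C"
  proof
    assume xC: "x \<in> C"
    have "\<not> C \<subseteq> {x}" using card2 card_mono[of "{x}" C] by auto
    then obtain b where b: "b \<in> C" "b \<noteq> x" by blast
    show False using xJ[OF xC b(1)] b(2) subset_join(1)[of x b] by simp
  qed
  have Mx: "\<not> y \<subseteq> join a x" if "a \<in> C" "y \<in> X" for a y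
  proof
    assume y: "y \<subseteq> join a x"
    have pts: "a \<in> pg_points" "y \<in> pg_points" "a \<noteq> y" "a \<noteq> x"
      using that X(2) assms(1) xC by blast+
    \<comment> \<open>The new centre was chosen off the joins of \<open>C\<close> with earlier
      centres; the converse condition follows by collinearity, since \<open>y\<close> on
      \<open>join a x\<close> puts \<open>x\<close> on \<open>join a y\<close>.\<close>
    have "join a x = join a y"
      using line_eq_join[OF pts(1-3) join_line[OF pts(1) x(1) pts(4)] subset_join(1) y] .
    then show False using xM[OF that] subset_join(2)[of x a] by simp
  qed
  have "x \<notin> X"
  proof
    assume "x \<in> X"
    moreover obtain a where "a \<in> C" using card2 by fastforce
    ultimately show False using xM[of a x] subset_join(2)[of x a] by simp
  qed
  then have "card (insert x X) = Suc n" using fin X(1) by simp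
  moreover have "insert x X \<subseteq> pg_points - C" using X(2) x(1) xC by simp
  moreover have "\<forall>u\<in>insert x X. \<forall>l\<in>L. \<not> u \<subseteq> l" using X(3) x(2) by simp
  moreover have "\<forall>u\<in>insert x X. \<forall>a\<in>C. \<forall>b\<in>C. a \<noteq> b \<longrightarrow> \<not> u \<subseteq> join a b"
    using X(4) xJ by simp
  moreover have "\<forall>u\<in>insert x X. \<forall>v\<in>insert x X. \<forall>a\<in>C. u \<noteq> v \<longrightarrow> \<not> u \<subseteq> join a v"
    using X(5) xM Mx by simp
  ultimately show ?case by (intro exI[of _ "insert x X"] conjI)
qed

section \<open>Gadgets inside the incidence graph\<close>

lemma incidence_edge_iff:
  "{u, Inr l} \<in> edges incidence_graph \<longleftrightarrow> (\<exists>a\<in>pg_points. u = Inl a \<and> l \<in> pg_lines \<and> a \<subseteq> l)"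
  by (simp add: incidence_graph_def doubleton_eq_iff; metis)

lemma incidence_edges_within:
  fixes V :: "(('a::{field,finite} ^ 3) set + ('a ^ 3) set) set"
  shows "{e \<in> edges incidence_graph. e \<subseteq> V} \<subseteq> complete_edges V"
proof
  fix e assume e: "e \<in> {e \<in> edges (incidence_graph :: (('a ^ 3) set + ('a ^ 3) set) graph). e \<subseteq> V}"
  then have "e \<in> complete_edges (verts (incidence_graph :: (('a ^ 3) set + ('a ^ 3) set) graph))"
    using simple_graph_incidence_graph[where 'a='a] unfolding simple_graph_def by blast
  then show "e \<in> complete_edges V" using e by (intro complete_edges_restrict[of e _ V]) simp_all
qed

text \<open>The avoidance conditions ensure that \<open>join x b\<close> contains no point of
  \<open>C\<close> except \<open>b\<close> and no centre except \<open>x\<close>, and that no centre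
  lies on a line of \<open>L\<close>. So the subgraph induced on \<open>C\<close>, \<open>L\<close>,
  the centres and the joins consists of \<open>E\<close> and the gadgets only.\<close>

lemma incidence_graph_gadgets:
  fixes C L X :: "('a::{field,finite} ^ 3) set set"
  defines "m \<equiv> \<lambda>(u :: ('a ^ 3) set + ('a ^ 3) set) (v :: ('a ^ 3) set + ('a ^ 3) set). Inr (join (projl u) (projl v))
      :: ('a ^ 3) set + ('a ^ 3) set"
    and "V \<equiv> Inl ` C \<union> Inr ` L"
    and "E \<equiv> {e \<in> edges incidence_graph. e \<subseteq> Inl ` C \<union> Inr ` L}"
  assumes C: "C \<subseteq> pg_points" and L: "L \<subseteq> pg_lines" and X: "X \<subseteq> pg_points - C"
    and XL: "\<And>x l. x \<in> X \<Longrightarrow> l \<in> L \<Longrightarrow> \<not> x \<subseteq> l"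
    and XC: "\<And>x a b. x \<in> X \<Longrightarrow> a \<in> C \<Longrightarrow> b \<in> C \<Longrightarrow> a \<noteq> b \<Longrightarrow> \<not> x \<subseteq> join a b"
    and XX: "\<And>x y a. x \<in> X \<Longrightarrow> y \<in> X \<Longrightarrow> a \<in> C \<Longrightarrow> x \<noteq> y \<Longrightarrow> \<not> x \<subseteq> join a y"
    and D: "sym_diff E F \<subseteq> complete_edges (Inl ` C)" and card: "card C \<le> card X + 1"
  shows "vertex_minor \<lparr>verts = V, edges = F\<rparr> incidence_graph"
proof -
  let ?G = "incidence_graph :: (('a ^ 3) set + ('a ^ 3) set) graph"
  let ?X = "(Inl :: ('a ^ 3) set \<Rightarrow> ('a ^ 3) set + ('a ^ 3) set) ` X"
  let ?C = "Inl ` C :: (('a ^ 3) set + ('a ^ 3) set) set"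
  let ?W = "V \<union> ?X \<union> case_prod m ` (?X \<times> ?C)"
  have line: "join x b \<in> pg_lines" if "x \<in> X" "b \<in> C" for x b
    using join_line[of x b] that C X by blast
  \<comment> \<open>Two distinct points of \<open>C\<close> on \<open>join x b\<close> would make it
    a join of points of \<open>C\<close> that contains the centre \<open>x\<close>.\<close>
  have onC: "a = b" if "x \<in> X" "a \<in> C" "b \<in> C" "a \<subseteq> join x b" for x a b
  proof (rule ccontr)
    assume ab: "a \<noteq> b"
    have "a \<in> pg_points" "b \<in> pg_points" using that C by blast+
    from line_eq_join[OF this ab line[OF that(1,3)] that(4) subset_join(2)]
    have "join x b = join a b" .
    then show False using XC[OF that(1-3) ab] subset_join(1)[of x b] by simp
  qed
  have onX: "y = x" if "x \<in> X" "y \<in> X" "b \<in> C" "y \<subseteq> join x b" for x y b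
    using XX[of y x b] that join_commute[of x b] by metis
  have m: "m (Inl x) (Inl b) = Inr (join x b)" for x b
    by (simp add: m_def)
  have W: "Inl a \<in> ?W \<longleftrightarrow> a \<in> C \<union> X" "Inr l \<in> ?W \<longleftrightarrow> l \<in> L \<or> (\<exists>x\<in>X. \<exists>b\<in>C. l = join x b)" for a l
    by (simp_all add: V_def m_def image_iff)
  \<comment> \<open>A connector determines its centre and its end in \<open>C\<close>, as the only
    points of \<open>X\<close> and of \<open>C\<close> on it.\<close>
  have inj: "inj_on (case_prod m) (?X \<times> ?C)"
  proof -
    have "x = y \<and> b = c" if "x \<in> X" "y \<in> X" "b \<in> C" "c \<in> C" "join x b = join y c" for x y b c
    proof
      show "x = y" using onX[of y x c] that subset_join(1)[of x b] by simp
      show "b = c" using onC[of y b c] that subset_join(2)[of b x] by simp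
    qed
    then show ?thesis by (simp add: inj_on_def m)
  qed
  have "{e \<in> edges ?G. e \<subseteq> ?W} = E \<union> gadget_edges ?X m ?C"
  proof
    show "{e \<in> edges ?G. e \<subseteq> ?W} \<subseteq> E \<union> gadget_edges ?X m ?C"
    proof
      fix e assume "e \<in> {e \<in> edges ?G. e \<subseteq> ?W}"
      then have e: "e \<in> edges ?G" "e \<subseteq> ?W" by blast+
      from e(1) obtain a l where al: "e = {Inl a, Inr l}" "a \<subseteq> l"
        unfolding incidence_graph_def by auto
      from e(2) have "a \<in> C \<union> X" "l \<in> L \<or> (\<exists>x\<in>X. \<exists>b\<in>C. l = join x b)"
        using W unfolding al(1) by simp_all
      then consider "a \<in> C" "l \<in> L" | "a \<in> X" "l \<in> L"
        | x b where "a \<in> C" "x \<in> X" "b \<in> C" "l = join x b"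
        | x b where "a \<in> X" "x \<in> X" "b \<in> C" "l = join x b" by blast
      then show "e \<in> E \<union> gadget_edges ?X m ?C"
      proof cases
        case 1
        then show ?thesis using e(1) al(1) by (simp add: E_def)
      next
        case 2
        then show ?thesis using al(2) XL by blast
      next
        case 3
        then have "a = b" using onC al(2) by metis
        then have "e = {m (Inl x) (Inl b), Inl b}"
          using al(1) 3(4) by (simp add: m insert_commute)
        then show ?thesis unfolding gadget_edges_def using 3 by blast
      next
        case 4
        then have "a = x" using onX al(2) by metis
        then have "e = {Inl x, m (Inl x) (Inl b)}"
          using al(1) 4(4) by (simp add: m)
        then show ?thesis unfolding gadget_edges_def using 4 by blast
      qed
    qed
    have E: "E \<subseteq> {e \<in> edges ?G. e \<subseteq> ?W}" unfolding E_def V_def by blast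
    have "{Inl x, m (Inl x) (Inl b)} \<in> {e \<in> edges ?G. e \<subseteq> ?W}"
      "{m (Inl x) (Inl b), Inl b} \<in> {e \<in> edges ?G. e \<subseteq> ?W}" if xb: "x \<in> X" "b \<in> C" for x b
    proof -
      have "x \<in> pg_points" "b \<in> pg_points" using xb C X by blast+
      then have edge: "{Inl x, Inr (join x b)} \<in> edges ?G" "{Inl b, Inr (join x b)} \<in> edges ?G"
        using line[OF xb] subset_join unfolding incidence_edge_iff by metis+
      have mem: "Inl x \<in> ?W" "Inl b \<in> ?W" "Inr (join x b) \<in> ?W"
        using xb W by blast+
      show "{Inl x, m (Inl x) (Inl b)} \<in> {e \<in> edges ?G. e \<subseteq> ?W}"
        unfolding m by (intro CollectI conjI edge(1) insert_subsetI mem empty_subsetI)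
      have "{Inl b, Inr (join x b)} \<in> {e \<in> edges ?G. e \<subseteq> ?W}"
        by (intro CollectI conjI edge(2) insert_subsetI mem empty_subsetI)
      then show "{m (Inl x) (Inl b), Inl b} \<in> {e \<in> edges ?G. e \<subseteq> ?W}"
        unfolding m by (subst insert_commute)
    qed
    note gadget = this
    have "gadget_edges ?X m ?C \<subseteq> {e \<in> edges ?G. e \<subseteq> ?W}"
    proof
      fix e assume "e \<in> gadget_edges ?X m ?C"
      then obtain x b where xb: "x \<in> X" "b \<in> C"
        and "e = {Inl x, m (Inl x) (Inl b)} \<or> e = {m (Inl x) (Inl b), Inl b}"
        unfolding gadget_edges_def by blast
      from this(3) show "e \<in> {e \<in> edges ?G. e \<subseteq> ?W}"
        by (elim disjE ssubst) (rule gadget[OF xb])+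
    qed
    with E show "E \<union> gadget_edges ?X m ?C \<subseteq> {e \<in> edges ?G. e \<subseteq> ?W}" by (rule Un_least)
  qed
  note edges_W = this
  have "?W \<subseteq> verts ?G"
  proof
    fix u assume u: "u \<in> ?W"
    show "u \<in> verts ?G"
    proof (cases u)
      case (Inl a)
      then have "a \<in> pg_points" using u W(1) C X by blast
      then show ?thesis using Inl by (simp add: incidence_graph_def InlI)
    next
      case (Inr l)
      then have "l \<in> pg_lines" using u W(2) L line by blast
      then show ?thesis using Inr by (simp add: incidence_graph_def InrI)
    qed
  qed
  from vertex_minor_induced[OF simple_graph_incidence_graph this]
  have "vertex_minor \<lparr>verts = ?W, edges = E \<union> gadget_edges ?X m ?C\<rparr> ?G"
    unfolding edges_W .
  moreover have "vertex_minor \<lparr>verts = V, edges = F\<rparr> \<lparr>verts = ?W, edges = E \<union> gadget_edges ?X m ?C\<rparr>"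
  proof (rule vertex_minor_gadgets)
    \<comment> \<open>The join contains the centre \<open>x\<close>, which lies on no line of
      \<open>L\<close>; so connectors are new vertices.\<close>
    have "join x b \<notin> L" if "x \<in> X" "b \<in> C" for x b
      using XL[of x "join x b"] that subset_join(1)[of x b] by blast
    then have "m (Inl x) (Inl b) \<notin> ?X \<union> V" if "x \<in> X" "b \<in> C" for x b
      using that unfolding m V_def by blast
    then show "case_prod m ` (?X \<times> ?C) \<inter> (?X \<union> V) = {}" by auto
    show "E \<subseteq> complete_edges V"
      unfolding E_def V_def by (rule incidence_edges_within)
    show "card ?C \<le> card ?X + 1" using card by (simp add: card_image)
    show "?X \<inter> V = {}" using X unfolding V_def by blast
  qed (use D inj in \<open>simp_all add: V_def\<close>)
  ultimately show ?thesis by (rule vertex_minor_trans[rotated])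
qed

section \<open>The numerical condition on \<open>k\<close> and \<open>q\<close>\<close>

text \<open>The sum bounds the number of lines that the last gadget centre has to avoid: the lines
  in the given vertex set, the joins inside \<open>C\<close>, and the joins of \<open>C\<close> with
  \<open>k - 2\<close> earlier centres.\<close>

lemma pg_universal_bounds:
  fixes q k :: nat
  assumes "q \<ge> 2" "k > 0" "7 * (int k)\<^sup>2 - 16 \<le> 4 * int q"
  shows "k \<le> q" "2 \<le> k \<Longrightarrow> k + (k choose 2) + k * (k - 2) \<le> q"
proof -
  show *: "k + (k choose 2) + k * (k - 2) \<le> q" if k: "2 \<le> k"
  proof -
    have "int (k * (k - 1)) = int k * int k - int k"
      using k by (simp add: of_nat_diff algebra_simps)
    moreover have "even (k * (k - 1))"
      by (cases "even k") auto
    then have "2 * (k choose 2) = k * (k - 1)"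
      by (simp add: choose_two)
    moreover have "int (k * (k - 2)) = int k * int k - 2 * int k"
      using k by (simp add: of_nat_diff algebra_simps)
    \<comment> \<open>\<open>(k + 8) (k - 2) = (7 k\<^sup>2 - 16) - 2 (3 k\<^sup>2 - 3 k)\<close>\<close>
    moreover have "0 \<le> (int k + 8) * (int k - 2)"
      using k by simp
    then have "0 \<le> int k * int k + 6 * int k - 16"
      by (simp add: algebra_simps)
    ultimately show ?thesis
      using assms(3) unfolding power2_eq_square by linarith
  qed
  \<comment> \<open>For \<open>k = 1\<close> the first bound comes from \<open>q\<close> being at
    least 2; otherwise \<open>k\<close> is a summand of the second bound.\<close>
  show "k \<le> q"
    using * assms(1,2) by (cases "k = 1") auto
qed

section \<open>Universality of the incidence graph\<close>

theorem theorem19: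
  fixes q k :: nat
  assumes "primepow q"
    and "CARD('a::{field,finite}) = q"
    and "k > 0"
    and "7 * (int k)\<^sup>2 - 16 \<le> 4 * int q"
  shows "vertex_minor_universal k
           (incidence_graph :: (('a ^ 3) set + ('a ^ 3) set) graph)"
proof -
  let ?G = "incidence_graph :: (('a ^ 3) set + ('a ^ 3) set) graph"
  have "q \<ge> 2" using card_field_ge_2[where 'a='a] assms(2) by simp
  note bounds = pg_universal_bounds[OF this assms(3,4)]
  have "k \<le> card (verts ?G)"
  proof -
    have "card (pg_points :: ('a ^ 3) set set) \<le> card (verts ?G)"
      by (simp add: incidence_graph_def card_Plus)
    then show ?thesis using card_pg_points_ge[where 'a='a] bounds(1) assms(2) by linarith
  qed
  moreover have "vertex_minor H ?G"
    if K: "K \<subseteq> verts ?G" "card K = k" and H: "simple_graph H" "verts H = K" for K H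
  proof -
    define P where "P = Inl -` K"
    define L where "L = Inr -` K"
    have PL: "P \<subseteq> pg_points" "L \<subseteq> pg_lines"
      using K(1) by (auto simp: P_def L_def incidence_graph_def)
    have K_eq: "K = P <+> L"
    proof (rule set_eqI)
      fix u show "u \<in> K \<longleftrightarrow> u \<in> P <+> L"
        by (cases u) (auto simp: P_def L_def)
    qed
    then have k: "card P + card L = k"
      using K(2) by (simp add: card_Plus)
    have "card P + card L \<le> CARD('a) + 1"
      using k bounds(1) assms(2) by simp
    from exists_points_on_lines[OF PL this] obtain p where
      "\<forall>l\<in>L. p l \<in> pg_points - P \<and> p l \<subseteq> l \<and> (\<forall>m\<in>L - {l}. \<not> p l \<subseteq> m)" ..
    then have p: "p l \<in> pg_points - P" "p l \<subseteq> l" "\<And>m. m \<in> L \<Longrightarrow> p l \<subseteq> m \<Longrightarrow> m = l"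
      if "l \<in> L" for l
      using that by blast+
    have inj_p: "inj_on p L"
    proof (rule inj_onI)
      fix l m assume "l \<in> L" "m \<in> L" "p l = p m"
      then show "l = m" using p(2)[of l] p(3)[of m l] by simp
    qed
    \<comment> \<open>The representatives \<open>p l\<close> are distinct and lie outside
      \<open>P\<close>, so \<open>C\<close> consists of exactly \<open>k\<close> points.\<close>
    define C where "C = P \<union> p ` L"
    have C: "C \<subseteq> pg_points" using PL(1) p(1) by (auto simp: C_def)
    have card_C: "card C = k"
      proof -
      have "P \<inter> p ` L = {}" using p(1) by blast
      then show ?thesis using k inj_p unfolding C_def by (simp add: card_Un_disjoint card_image)
    qed
    have "k - 1 > 0 \<longrightarrow> 2 \<le> card C \<and> card L + (card C choose 2) + card C * (k - 1 - 1) \<le> CARD('a)"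
    proof
      assume "k - 1 > 0"
      then have *: "2 \<le> k" "k - 1 - 1 = k - 2" by simp_all
      then show "2 \<le> card C \<and> card L + (card C choose 2) + card C * (k - 1 - 1) \<le> CARD('a)"
        unfolding card_C *(2) using bounds(2)[OF *(1)] k assms(2) by linarith
    qed
    from exists_gadget_centres[OF C PL(2) this]
    obtain X where X: "card X = k - 1" "X \<subseteq> pg_points - C" "\<forall>x\<in>X. \<forall>l\<in>L. \<not> x \<subseteq> l"
      "\<forall>x\<in>X. \<forall>a\<in>C. \<forall>b\<in>C. a \<noteq> b \<longrightarrow> \<not> x \<subseteq> join a b"
      "\<forall>x\<in>X. \<forall>y\<in>X. \<forall>a\<in>C. x \<noteq> y \<longrightarrow> \<not> x \<subseteq> join a y"
      by (elim exE conjE)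
    define p' where "p' = (\<lambda>l :: ('a ^ 3) set + ('a ^ 3) set. Inl (p (projr l)) :: ('a ^ 3) set + ('a ^ 3) set)"
    \<comment> \<open>The prescribed neighbours of a line are the points of \<open>P\<close> on it.
      Together with \<open>p l\<close> these are all the points of \<open>C\<close> on
      \<open>l\<close>, so \<open>G\<close> has the edges of the plane at every line of
      \<open>L\<close>.\<close>
    define A where "A = (\<lambda>l :: ('a ^ 3) set + ('a ^ 3) set. Inl ` {a \<in> P. a \<subseteq> projr l} :: (('a ^ 3) set + ('a ^ 3) set) set)"
    have p'_img: "p' ` (Inr ` L) = Inl ` p ` L" by (auto simp: p'_def image_image)
    have "\<exists>G. simple_graph G \<and> verts G = K \<union> p' ` (Inr ` L) \<and> vertex_minor H G \<and>
        (\<forall>l\<in>Inr ` L. neighborhood G l = insert (p' l) (A l))"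
    proof (rule exists_pendant_extension)
      show "inj_on p' (Inr ` L)" using inj_p by (auto simp: inj_on_def p'_def)
      show "p' ` Inr ` L \<inter> K = {}" using p(1) by (auto simp: p'_def K_eq)
      show "A l \<subseteq> K - Inr ` L" for l by (auto simp: A_def K_eq)
      show "Inr ` L \<subseteq> K" by (auto simp: K_eq)
    qed (use H in auto)
    then obtain G where G0: "simple_graph G" "verts G = K \<union> p' ` (Inr ` L)" "vertex_minor H G"
      "\<forall>l\<in>Inr ` L. neighborhood G l = insert (p' l) (A l)" by (elim exE conjE)
    have V: "K \<union> p' ` (Inr ` L) = Inl ` C \<union> Inr ` L"
      by (auto simp: p'_img K_eq C_def)
    have G: "simple_graph G" "verts G = Inl ` C \<union> Inr ` L"
      "\<And>l. l \<in> L \<Longrightarrow> neighborhood G (Inr l) = insert (Inl (p l)) (Inl ` {a \<in> P. a \<subseteq> l})"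
      using G0 unfolding V by (simp_all add: p'_def A_def)
    have "vertex_minor \<lparr>verts = Inl ` C \<union> Inr ` L, edges = edges G\<rparr> ?G"
    proof (rule incidence_graph_gadgets[OF C PL(2) X(2)])
      let ?E = "{e \<in> edges ?G. e \<subseteq> Inl ` C \<union> Inr ` L}"
      \<comment> \<open>It remains to see that no pair with a line of \<open>L\<close> is wrong; the
        gadgets repair the pairs of points.\<close>
      show "sym_diff ?E (edges G) \<subseteq> complete_edges (Inl ` C)"
      proof
        fix e assume e: "e \<in> sym_diff ?E (edges G)"
        then consider "e \<in> edges G" | "e \<in> ?E" by (elim UnE DiffE)
        then have eV: "e \<in> complete_edges (Inl ` C \<union> Inr ` L)"
        proof cases
          case 1
          have "edges G \<subseteq> complete_edges (Inl ` C \<union> Inr ` L)"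
            using G(1) unfolding simple_graph_def G(2) by (rule conjunct2)
          then show ?thesis using 1 by (rule subsetD)
        next
          case 2
          then show ?thesis by (rule subsetD[OF incidence_edges_within])
        qed
        have "Inr l \<notin> e" for l
        proof
          assume l: "Inr l \<in> e"
          obtain u where u: "e = {u, Inr l}" "u \<in> Inl ` C \<union> Inr ` L" "Inr l \<in> Inl ` C \<union> Inr ` L"
            using eV l by (rule complete_edges_incidentE)
          from u(3) have lL: "l \<in> L" by blast
          have "e \<in> edges G \<longleftrightarrow> u \<in> insert (Inl (p l)) (Inl ` {a \<in> P. a \<subseteq> l})"
            unfolding G(3)[OF lL, symmetric] by (simp add: neighborhood_def u(1))
          also have "\<dots> \<longleftrightarrow> (\<exists>a\<in>C. u = Inl a \<and> a \<subseteq> l)"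
          proof
            assume "u \<in> insert (Inl (p l)) (Inl ` {a \<in> P. a \<subseteq> l})"
            then show "\<exists>a\<in>C. u = Inl a \<and> a \<subseteq> l"
              using p(2)[OF lL] lL unfolding C_def by blast
          next
            assume "\<exists>a\<in>C. u = Inl a \<and> a \<subseteq> l"
            then obtain a where a: "a \<in> P \<union> p ` L" "u = Inl a" "a \<subseteq> l"
              unfolding C_def by blast
            show "u \<in> insert (Inl (p l)) (Inl ` {a \<in> P. a \<subseteq> l})"
            proof (cases "a \<in> P")
              case True
              then show ?thesis using a(2,3) by blast
            next
              case False
              then obtain m where "m \<in> L" "a = p m" using a(1) by blast
              \<comment> \<open>A representative \<open>p m\<close> lies on no line of
                \<open>L\<close> other than \<open>m\<close>, so it meets \<open>l\<close> only for
                \<open>m = l\<close>.\<close>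
              then show ?thesis using p(3)[of m l] a(2,3) lL by simp
            qed
          qed
          also have "\<dots> \<longleftrightarrow> e \<in> edges ?G"
            unfolding u(1) incidence_edge_iff
          proof
            assume "\<exists>a\<in>C. u = Inl a \<and> a \<subseteq> l"
            then show "\<exists>a\<in>pg_points. u = Inl a \<and> l \<in> pg_lines \<and> a \<subseteq> l"
              using C PL(2) lL by blast
          next
            assume "\<exists>a\<in>pg_points. u = Inl a \<and> l \<in> pg_lines \<and> a \<subseteq> l"
            then obtain a where a: "u = Inl a" "a \<subseteq> l" by blast
            then have "a \<in> C" using u(2) by blast
            with a show "\<exists>a\<in>C. u = Inl a \<and> a \<subseteq> l" by blast
          qed
          also have "\<dots> \<longleftrightarrow> e \<in> ?E"
            using u by simp
          finally show False using e by blast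
        qed
        then have "e \<subseteq> Inl ` C" using eV by (elim complete_edgesE) blast
        then show "e \<in> complete_edges (Inl ` C)"
          using complete_edges_restrict[OF eV] by blast
      qed
    qed (use X(1,3-5) card_C in simp_all)
    moreover have "\<lparr>verts = Inl ` C \<union> Inr ` L, edges = edges G\<rparr> = G"
      using G(2) by (cases G) simp
    ultimately show ?thesis using vertex_minor_trans[OF G0(3)] by simp
  qed
  ultimately show ?thesis by (auto simp: vertex_minor_universal_def)
qed

end
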